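(* Let $a<b$, $c<d$, $p<q$ be real numbers, let $G=[a,b]\times[c,d]\times[p,q]\subset\mathbb{R}^3$, and let $f:G\to\mathbb{R}$ be convex on $G$. Define $H:[0,1]^3\to\mathbb{R}$ by $$ H(t,s,r)=\frac{1}{(b-a)(d-c)(q-p)}\int_a^b\int_c^d\int_p^q f\left(tx+(1-t)\tfrac{a+b}{2},\; sy+(1-s)\tfrac{c+d}{2},\; rz+(1-r)\tfrac{p+q}{2}\right)dx\,dy\,dz, $$ where $x$ ranges over $[a,b]$, $y$ over $[c,d]$ and $z$ over $[p,q]$. Then: (i) $H$ is convex on the co-ordinates on $[0,1]^3$. (ii) The following bounds hold: $$ \sup_{(t,s,r)\in[0,1]^3}H(t,s,r)=\frac{1}{(b-a)(d-c)(q-p)}\iiint_G f(x,y,z)\,dy\,dz\,dx=H(1,1,1), $$ $$ \inf_{(t,s,r)\in[0,1]^3}H(t,s,r)=f\left(\tfrac{a+b}{2},\tfrac{c+d}{2},\tfrac{p+q}{2}\right)=H(0,0,0). $$ (iii) $H$ is monotonic nondecreasing on the co-ordinates.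
   Context: A function $f:G\to\mathbb{R}$ on a rectangular box $G=[a,b]\times[c,d]\times[p,q]$ is convex on $G$ if $f(tx+(1-t)u,\,ty+(1-t)v,\,tz+(1-t)w)\le t f(x,y,z)+(1-t)f(u,v,w)$ for all $(x,y,z),(u,v,w)\in G$ and $t\in[0,1]$. A real function $g$ on a rectangular box $I_1\times I_2\times I_3$ is convex on the co-ordinates if the partial mappings obtained by fixing one variable are convex functions of the remaining two: for every $x\in I_1$ the map $(y,z)\mapsto g(x,y,z)$ is convex on $I_2\times I_3$; for every $y\in I_2$ the map $(x,z)\mapsto g(x,y,z)$ is convex on $I_1\times I_3$; and for every $z\in I_3$ the map $(x,y)\mapsto g(x,y,z)$ is convex on $I_1\times I_2$. A function on $[0,1]^3$ is monotonic nondecreasing on the co-ordinates if it is nondecreasing in each of its three variables separately when the other two are held fixed. *)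

theory Defs
  imports "HOL-Analysis.Analysis"
begin

definition convex_on_coords ::
  "real set \<Rightarrow> real set \<Rightarrow> real set \<Rightarrow> (real \<times> real \<times> real \<Rightarrow> real) \<Rightarrow> bool" where
  "convex_on_coords I1 I2 I3 g \<longleftrightarrow>
     (\<forall>x\<in>I1. convex_on (I2 \<times> I3) (\<lambda>(y, z). g (x, y, z))) \<and>
     (\<forall>y\<in>I2. convex_on (I1 \<times> I3) (\<lambda>(x, z). g (x, y, z))) \<and>
     (\<forall>z\<in>I3. convex_on (I1 \<times> I2) (\<lambda>(x, y). g (x, y, z)))"

definition nondecreasing_on_coords ::
  "real set \<Rightarrow> real set \<Rightarrow> real set \<Rightarrow> (real \<times> real \<times> real \<Rightarrow> real) \<Rightarrow> bool" where
  "nondecreasing_on_coords I1 I2 I3 g \<longleftrightarrow>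
     (\<forall>y\<in>I2. \<forall>z\<in>I3. mono_on I1 (\<lambda>x. g (x, y, z))) \<and>
     (\<forall>x\<in>I1. \<forall>z\<in>I3. mono_on I2 (\<lambda>y. g (x, y, z))) \<and>
     (\<forall>x\<in>I1. \<forall>y\<in>I2. mono_on I3 (\<lambda>z. g (x, y, z)))"

text \<open>The mapping \<open>H\<close> associated with \<open>f\<close> on the box \<open>[a,b] \<times> [c,d] \<times> [p,q]\<close>. The three
  integral signs are read as an iterated integral, with \<open>x\<close> outermost and \<open>z\<close> innermost.
  For \<open>(t,s,r)\<close> in the unit cube, \<open>f\<close> is evaluated only at points of the box.\<close>

definition hadamard_map ::
  "real \<Rightarrow> real \<Rightarrow> real \<Rightarrow> real \<Rightarrow> real \<Rightarrow> real \<Rightarrow>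
   (real \<times> real \<times> real \<Rightarrow> real) \<Rightarrow> real \<times> real \<times> real \<Rightarrow> real" where
  "hadamard_map a b c d p q f = (\<lambda>(t, s, r).
     1 / ((b - a) * (d - c) * (q - p)) *
     integral {a..b} (\<lambda>x. integral {c..d} (\<lambda>y. integral {p..q} (\<lambda>z.
       f (t * x + (1 - t) * ((a + b) / 2),
          s * y + (1 - s) * ((c + d) / 2),
          r * z + (1 - r) * ((p + q) / 2))))))"

end

theory Submission
  imports Defs
begin

text \<open>
  The mapping \<open>H\<close> is a threefold application of a single operator on functions of one
  variable: the mean of \<open>h\<close> over \<open>[a,b]\<close> after \<open>[a,b]\<close> has been contracted by
  the factor \<open>t\<close> towards its midpoint. Each application replaces one of the variables
  \<open>z\<close>, \<open>y\<close>, \<open>x\<close> by its factor \<open>r\<close>, \<open>s\<close>, \<open>t\<close>. Everything follows from four properties of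
  the operator on convex functions.

  \<^item> It preserves joint convexity with further parameters (\<open>convex_on_contracted_mean_joint\<close>):
    for fixed \<open>x\<close> the contracted point is an affine function of \<open>t\<close>, and integrating a family
    of convex functions gives a convex function. Hence \<open>H\<close> is even jointly convex on the cube,
    and all the intermediate functions are convex.
  \<^item> At \<open>t = 0\<close> its value is the value of \<open>h\<close> at the midpoint, and this is its least value
    (\<open>midpoint_le_contracted_mean\<close>): pair each point with its mirror image.
  \<^item> Being convex in \<open>t\<close> with its minimum at \<open>0\<close>, it is nondecreasing in \<open>t\<close>
    (\<open>contracted_mean_mono\<close>).
  \<^item> It is monotone in \<open>h\<close> (\<open>contracted_mean_le\<close>), so that the monotonicity of an inner mean
    survives the outer ones.

  The infimum and supremum are therefore attained at the two extreme corners of the cube. The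
  value at \<open>(1,1,1)\<close> is an iterated integral, and identifying it with the integral over the box
  is Fubini's theorem (\<open>integral_cbox_times_convex\<close>). The function \<open>f\<close> may jump at the boundary
  of the box, but it is bounded, and continuous in the interior; this suffices for all the
  integrability questions.
\<close>

section \<open>Integrability of convex functions on boxes\<close>

text \<open>
  Slices, permutations of the coordinates and contractions are all affine; this lemma is the
  common reason why they preserve convexity.
\<close>

lemma convex_on_compose_affine:
  assumes "convex_on T g" and "convex S" and "\<And>v. v \<in> S \<Longrightarrow> A v \<in> T"
    and "\<And>u v w. v \<in> S \<Longrightarrow> w \<in> S \<Longrightarrow> A ((1 - u) *\<^sub>R v + u *\<^sub>R w) = (1 - u) *\<^sub>R A v + u *\<^sub>R A w"
  shows "convex_on S (\<lambda>v. g (A v))"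
proof (rule convex_onI)
  fix u :: real and v w
  assume "0 < u" "u < 1" "v \<in> S" "w \<in> S"
  then show "g (A ((1 - u) *\<^sub>R v + u *\<^sub>R w)) \<le> (1 - u) * g (A v) + u * g (A w)"
    using convex_onD[OF assms(1), of u "A v" "A w"] assms(3,4) by simp
qed (rule assms)

text \<open>
  A box is the convex hull of finitely many points, which gives an upper bound. The lower bound
  comes from reflection in the centre \<open>m\<close>: since \<open>m\<close> is the midpoint of \<open>x\<close> and its mirror
  image \<open>x'\<close>, convexity gives \<open>g x \<ge> 2 g m - g x'\<close>, and \<open>g x'\<close> is bounded above.
\<close>

lemma convex_on_cbox_bounded:
  fixes g :: "'a::euclidean_space \<Rightarrow> real"
  assumes "convex_on (cbox u v) g"
  obtains B where "\<And>x. x \<in> cbox u v \<Longrightarrow> \<bar>g x\<bar> \<le> B"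
proof -
  obtain S where S: "finite S" "cbox u v = convex hull S"
    by (rule closed_interval_as_convex_hull)
  define M where "M = Max (insert 0 (g ` S))"
  have "\<forall>x\<in>S. g x \<le> M"
    using S(1) by (auto simp: M_def)
  then have upper: "g x \<le> M" if "x \<in> cbox u v" for x
    using convex_on_convex_hull_bound[of S g M] assms S(2) that by auto
  define m where "m = (1/2) *\<^sub>R (u + v)"
  have lower: "2 * g m - M \<le> g x" if x: "x \<in> cbox u v" for x
  proof -
    have x': "u + v - x \<in> cbox u v"
      using x by (auto simp: mem_box inner_diff_left inner_add_left)
    have "(1 - 1/2) *\<^sub>R x + (1/2) *\<^sub>R (u + v - x) = m"
      by (simp add: m_def algebra_simps)
    then have "g m \<le> (1 - 1/2) * g x + (1/2) * g (u + v - x)"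
      using convex_onD[OF assms, of "1/2" x "u + v - x"] x x' by simp
    with upper[OF x'] show ?thesis by simp
  qed
  show thesis
  proof (rule that)
    fix x assume "x \<in> cbox u v"
    then show "\<bar>g x\<bar> \<le> \<bar>M\<bar> + \<bar>2 * g m - M\<bar>"
      using upper[of x] lower[of x] by linarith
  qed
qed

text \<open>
  A convex function is continuous on an open set, hence Borel measurable there; on the faces of the
  closed box it may jump, and the faces are null sets.
\<close>

lemma convex_on_box_set_integrable:
  fixes g :: "'a::euclidean_space \<Rightarrow> real"
  assumes "convex_on (cbox u v) g"
  shows "set_integrable lborel (box u v) g"
proof -
  obtain B where B: "\<And>x. x \<in> cbox u v \<Longrightarrow> \<bar>g x\<bar> \<le> B"
    using convex_on_cbox_bounded[OF assms] by blast
  have "continuous_on (box u v) g"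
    using convex_on_subset[OF assms box_subset_cbox convex_box(2)]
    by (rule convex_on_continuous[OF open_box])
  then have meas: "(\<lambda>x. indicator (box u v) x *\<^sub>R g x) \<in> borel_measurable lborel"
    using borel_measurable_continuous_on_indicator[of "box u v" g] by simp
  have "integrable lborel (\<lambda>x. indicator (box u v) x *\<^sub>R g x)"
  proof (rule integrableI_bounded_set[where A = "box u v" and B = B])
    show "emeasure lborel (box u v) < \<infinity>"
      by (rule emeasure_bounded_finite) simp
    show "AE x in lborel. x \<in> box u v \<longrightarrow> norm (indicator (box u v) x *\<^sub>R g x) \<le> B"
      using B box_subset_cbox by (intro AE_I2) (auto simp: indicator_def)
  qed (use meas in auto)
  then show ?thesis
    by (simp add: set_integrable_def)
qed

lemma convex_on_cbox_integrable:
  fixes g :: "'a::euclidean_space \<Rightarrow> real"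
  assumes "convex_on (cbox u v) g"
  shows "g integrable_on cbox u v"
  using set_borel_integral_eq_integral(1)[OF convex_on_box_set_integrable[OF assms]]
  by (simp add: integrable_on_open_interval)

lemma convex_on_Icc_integrable:
  fixes g :: "real \<Rightarrow> real"
  assumes "convex_on {a..b} g"
  shows "g integrable_on {a..b}"
  using convex_on_cbox_integrable[of a b g] assms by simp

lemma convex_on_slice:
  assumes "convex_on (S \<times> T) F" and "convex T" and "x \<in> S"
  shows "convex_on T (\<lambda>y. F (x, y))"
  by (rule convex_on_compose_affine[OF assms(1,2)]) (use assms(3) in \<open>auto simp: algebra_simps\<close>)

text \<open>
  Integration is linear and monotone, so it carries the convexity inequality in the parameter
  \<open>v\<close> from the integrands over to the integrals.
\<close>

lemma convex_on_integral:
  fixes g :: "'v::real_vector \<Rightarrow> 'a::euclidean_space \<Rightarrow> real"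
  assumes "convex C"
    and conv: "\<And>x. x \<in> S \<Longrightarrow> convex_on C (\<lambda>v. g v x)"
    and int: "\<And>v. v \<in> C \<Longrightarrow> g v integrable_on S"
  shows "convex_on C (\<lambda>v. integral S (g v))"
proof (rule convex_onI)
  fix u :: real and v w
  assume u: "0 < u" "u < 1" and vw: "v \<in> C" "w \<in> C"
  have mem: "(1 - u) *\<^sub>R v + u *\<^sub>R w \<in> C"
    using \<open>convex C\<close> u vw by (simp add: convex_alt)
  have "integral S (g ((1 - u) *\<^sub>R v + u *\<^sub>R w)) \<le> integral S (\<lambda>x. (1 - u) * g v x + u * g w x)"
    using u vw
    by (intro integral_le int[OF mem] integrable_add integrable_on_mult_right int[OF vw(1)] int[OF vw(2)]
        convex_onD[OF conv]) auto
  also have "\<dots> = (1 - u) * integral S (g v) + u * integral S (g w)"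
    using int[OF vw(1)] int[OF vw(2)] by (simp add: integral_add integrable_on_mult_right integral_mult_right)
  finally show "integral S (g ((1 - u) *\<^sub>R v + u *\<^sub>R w)) \<le> \<dots>" .
qed (rule assms)

text \<open>
  Fubini's theorem for Lebesgue integrals is applied to \<open>f\<close> cut off outside the open box. The faces
  of the box are null sets, and for every \<open>x\<close> in the open box the slice \<open>f (x, \<cdot>)\<close> is itself convex,
  so all Lebesgue integrals involved agree with the gauge integrals over the closed boxes.
\<close>

lemma integral_cbox_times_convex:
  fixes f :: "'a::euclidean_space \<times> 'b::euclidean_space \<Rightarrow> real"
  assumes f: "convex_on (cbox u v \<times> cbox u' v') f"
  shows "integral (cbox u v \<times> cbox u' v') f =
    integral (cbox u v) (\<lambda>x. integral (cbox u' v') (\<lambda>y. f (x, y)))"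
proof -
  define g where "g = (\<lambda>z. indicator (box u v \<times> box u' v') z *\<^sub>R f z)"
  have box: "box (u, u') (v, v') = box u v \<times> box u' v'"
    by (auto simp: box_def Basis_prod_def ball_Un)
  have cbox: "cbox (u, u') (v, v') = cbox u v \<times> cbox u' v'"
    by (simp add: cbox_Pair_eq)
  have f_int: "set_integrable lborel (box u v \<times> box u' v') f"
    using convex_on_box_set_integrable[of "(u, u')" "(v, v')" f] f box cbox by simp
  then have g_int: "integrable (lborel \<Otimes>\<^sub>M lborel) g"
    by (simp add: g_def set_integrable_def lborel_prod)
  have inner: "(\<integral>y. g (x, y) \<partial>lborel) =
      indicator (box u v) x *\<^sub>R integral (cbox u' v') (\<lambda>y. f (x, y))" for x
  proof (cases "x \<in> box u v")
    case True
    then have "x \<in> cbox u v"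
      using box_subset_cbox by blast
    then have "convex_on (cbox u' v') (\<lambda>y. f (x, y))"
      using convex_on_slice[OF f] by simp
    from set_borel_integral_eq_integral(2)[OF convex_on_box_set_integrable[OF this]]
    show ?thesis
      using True by (simp add: g_def set_lebesgue_integral_def indicator_times integral_open_interval)
  qed (simp add: g_def indicator_times)
  have "integral (cbox u v \<times> cbox u' v') f = integral (box u v \<times> box u' v') f"
    using integral_open_interval[of "(u, u')" "(v, v')" f] by (simp only: box cbox)
  also have "\<dots> = (\<integral>z. g z \<partial>(lborel \<Otimes>\<^sub>M lborel))"
    using set_borel_integral_eq_integral(2)[OF f_int]
    by (simp add: g_def set_lebesgue_integral_def lborel_prod)
  also have "\<dots> = (\<integral>x. (\<integral>y. g (x, y) \<partial>lborel) \<partial>lborel)"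
    by (rule lborel_pair.integral_fst'[OF g_int, symmetric])
  also have "\<dots> = (LINT x : box u v | lborel. integral (cbox u' v') (\<lambda>y. f (x, y)))"
    by (simp add: inner set_lebesgue_integral_def)
  also have "\<dots> = integral (box u v) (\<lambda>x. integral (cbox u' v') (\<lambda>y. f (x, y)))"
    by (rule set_borel_integral_eq_integral(2))
      (use lborel_pair.integrable_fst'[OF g_int] in \<open>simp add: inner set_integrable_def\<close>)
  finally show ?thesis
    by (simp only: integral_open_interval)
qed

section \<open>Means over intervals contracted to their midpoint\<close>

definition contracted_mean :: "real \<Rightarrow> real \<Rightarrow> (real \<Rightarrow> real) \<Rightarrow> real \<Rightarrow> real" where
  "contracted_mean a b h t = 1 / (b - a) * integral {a..b} (\<lambda>x. h (t * x + (1 - t) * ((a + b) / 2)))"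

lemma contraction_in_Icc:
  fixes a b t x :: real
  assumes "t \<in> {0..1}" and "x \<in> {a..b}"
  shows "t * x + (1 - t) * ((a + b) / 2) \<in> {a..b}"
proof -
  have "(a + b) / 2 \<in> {a..b}"
    using assms(2) by auto
  then have "t *\<^sub>R x + (1 - t) *\<^sub>R ((a + b) / 2) \<in> {a..b}"
    using assms by (intro convexD convex_real_interval) auto
  then show ?thesis by simp
qed

lemma convex_on_contraction:
  assumes h: "convex_on {a..b} h" and t: "t \<in> {0..1::real}"
  shows "convex_on {a..b} (\<lambda>x. h (t * x + (1 - t) * ((a + b) / 2)))"
  by (rule convex_on_compose_affine[OF h])
    (use contraction_in_Icc[OF t] in \<open>auto simp: algebra_simps add_divide_distrib diff_divide_distrib\<close>)

lemma contraction_integrable: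
  assumes h: "convex_on {a..b} h" and t: "t \<in> {0..1::real}"
  shows "(\<lambda>x. h (t * x + (1 - t) * ((a + b) / 2))) integrable_on {a..b}"
  by (rule convex_on_Icc_integrable[OF convex_on_contraction[OF assms]])

text \<open>
  For fixed \<open>x\<close>, the point \<open>t * x + (1 - t) * ((a + b) / 2)\<close> is affine in \<open>t\<close>. The integrand is thus
  a convex function of \<open>(k, t)\<close>, and so is its integral. The parameter \<open>k\<close> carries the
  variables that the mean leaves alone, so that the lemma can be applied once per variable.
\<close>

lemma convex_on_contracted_mean_joint:
  assumes "a < b" and K: "convex K" and F: "convex_on (K \<times> {a..b}) F"
  shows "convex_on (K \<times> {0..1}) (\<lambda>(k, t). contracted_mean a b (\<lambda>x. F (k, x)) t)"
proof -
  define G where "G = (\<lambda>v x. F (fst v, snd v * x + (1 - snd v) * ((a + b) / 2)))"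
  have "convex_on (K \<times> {0..1}) (\<lambda>v. integral {a..b} (G v))"
  proof (rule convex_on_integral)
    show C: "convex (K \<times> {0..1::real})"
      by (intro convex_Times K) simp
    fix x assume x: "x \<in> {a..b}"
    show "convex_on (K \<times> {0..1}) (\<lambda>v. G v x)"
      unfolding G_def
      by (rule convex_on_compose_affine[OF F C])
        (use contraction_in_Icc[OF _ x] in \<open>auto simp: algebra_simps add_divide_distrib diff_divide_distrib\<close>)
  next
    fix v assume "v \<in> K \<times> {0..1::real}"
    then show "G v integrable_on {a..b}"
      using contraction_integrable[OF convex_on_slice[OF F], of "fst v" "snd v"]
      by (auto simp: G_def)
  qed
  then have "convex_on (K \<times> {0..1}) (\<lambda>v. 1 / (b - a) * integral {a..b} (G v))"
    by (rule convex_on_cmul[rotated]) (use \<open>a < b\<close> in simp)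
  then show ?thesis
    by (simp add: contracted_mean_def G_def case_prod_unfold)
qed

lemma contracted_mean_0:
  assumes "a < b"
  shows "contracted_mean a b h 0 = h ((a + b) / 2)"
  using assms by (simp add: contracted_mean_def)

lemma contracted_mean_le:
  assumes "a < b" and g: "convex_on {a..b} g" and h: "convex_on {a..b} h" and t: "t \<in> {0..1}"
    and le: "\<And>x. x \<in> {a..b} \<Longrightarrow> g x \<le> h x"
  shows "contracted_mean a b g t \<le> contracted_mean a b h t"
  unfolding contracted_mean_def
  using \<open>a < b\<close>
  by (intro mult_left_mono integral_le contraction_integrable[OF _ t] g h le contraction_in_Icc[OF t]) auto

text \<open>
  This is the lower Hermite-Hadamard inequality for the contracted function \<open>k\<close>. The reflection
  \<open>x \<mapsto> a + b - x\<close> leaves the integral of \<open>k\<close> unchanged, and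
  \<open>k x + k (a + b - x) \<ge> 2 k ((a + b) / 2)\<close> by convexity.
\<close>

lemma midpoint_le_contracted_mean:
  assumes "a < b" and h: "convex_on {a..b} h" and t: "t \<in> {0..1}"
  shows "h ((a + b) / 2) \<le> contracted_mean a b h t"
proof -
  define k where "k = (\<lambda>x. h (t * x + (1 - t) * ((a + b) / 2)))"
  have k: "(k has_integral integral {a..b} k) {a..b}"
    unfolding k_def by (intro integrable_integral contraction_integrable h t)
  have "(\<lambda>x. a + b - x) ` {a..b} = {a..b}"
    by (simp add: image_diff_atLeastAtMost)
  then have k': "((\<lambda>x. k (a + b - x)) has_integral integral {a..b} k) {a..b}"
    using has_integral_affinity[of k _ a b "-1" "a + b"] k by simp
  have "2 * k ((a + b) / 2) \<le> k x + k (a + b - x)" if "x \<in> {a..b}" for x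
  proof -
    have "convex_on {a..b} k"
      unfolding k_def by (rule convex_on_contraction[OF h t])
    from convex_onD[OF this, of "1/2" x "a + b - x"] that
    show ?thesis by (simp add: field_simps)
  qed
  then have "integral {a..b} k + integral {a..b} k \<ge> (b - a) * (2 * k ((a + b) / 2))"
    using has_integral_le[OF _ has_integral_add[OF k k']]
      has_integral_const_real[of "2 * k ((a + b) / 2)" a b] \<open>a < b\<close> by force
  moreover have "k ((a + b) / 2) = h ((a + b) / 2)"
    by (simp add: k_def algebra_simps add_divide_distrib diff_divide_distrib)
  ultimately have "h ((a + b) / 2) \<le> 1 / (b - a) * integral {a..b} k"
    using \<open>a < b\<close> by (simp add: field_simps)
  then show ?thesis
    by (simp only: contracted_mean_def k_def)
qed

text \<open>
  The mean is convex in \<open>t\<close> and minimal at \<open>t = 0\<close>, and a convex function cannot decrease when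
  moving away from a minimum: for \<open>s \<le> t\<close> the point \<open>s\<close> is a convex combination of \<open>0\<close> and \<open>t\<close>.
\<close>

lemma contracted_mean_mono:
  assumes "a < b" and h: "convex_on {a..b} h"
  shows "mono_on {0..1} (contracted_mean a b h)"
proof (rule mono_onI)
  fix s t :: real
  assume st: "s \<in> {0..1}" "t \<in> {0..1}" "s \<le> t"
  show "contracted_mean a b h s \<le> contracted_mean a b h t"
  proof (cases "t = 0")
    case False
    \<comment> \<open>A one-point parameter set turns joint convexity into convexity in the factor alone.\<close>
    have "convex_on ({0::real} \<times> {a..b}) (\<lambda>v. h (snd v))"
      by (rule convex_on_compose_affine[OF h]) (auto intro: convex_Times)
    then have "convex_on {0..1} (contracted_mean a b h)"
      using convex_on_slice[OF convex_on_contracted_mean_joint[OF \<open>a < b\<close>, of "{0::real}" "\<lambda>v. h (snd v)"]]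
      by (simp add: case_prod_unfold)
    from convex_onD[OF this, of "s / t" 0 t] st False
    have "contracted_mean a b h s \<le>
        (1 - s / t) * contracted_mean a b h 0 + s / t * contracted_mean a b h t"
      by (simp add: field_simps)
    also have "\<dots> \<le> (1 - s / t) * contracted_mean a b h t + s / t * contracted_mean a b h t"
      using st False midpoint_le_contracted_mean[OF \<open>a < b\<close> h st(2)]
      by (intro add_right_mono mult_left_mono) (auto simp: contracted_mean_0[OF \<open>a < b\<close>] field_simps)
    finally show ?thesis by (simp add: algebra_simps)
  qed (use st in simp)
qed

section \<open>The mapping as an iterated contracted mean\<close>

lemma hadamard_map_eq_contracted_means:
  "hadamard_map a b c d p q f (t, s, r) =
    contracted_mean a b (\<lambda>x. contracted_mean c d (\<lambda>y. contracted_mean p q (\<lambda>z. f (x, y, z)) r) s) t"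
  by (simp add: hadamard_map_def contracted_mean_def)

text \<open>
  The variables are replaced from the inside out: \<open>z\<close> by \<open>r\<close>, then \<open>y\<close> by \<open>s\<close>, then \<open>x\<close> by \<open>t\<close>.
  Before each step the variable to be averaged is moved to the last position by a linear
  permutation of the coordinates, which preserves convexity. The intermediate functions are
  needed as well, since monotonicity of the means presupposes convexity of what is averaged.
\<close>

lemma convex_on_iterated_contracted_means:
  fixes a b c d p q :: real
  assumes "a < b" and "c < d" and "p < q"
    and f: "convex_on ({a..b} \<times> {c..d} \<times> {p..q}) f"
  shows "convex_on (({a..b} \<times> {c..d}) \<times> {0..1})
      (\<lambda>((x, y), r). contracted_mean p q (\<lambda>z. f (x, y, z)) r)"
    and "convex_on (({a..b} \<times> {0..1}) \<times> {0..1})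
      (\<lambda>((x, r), s). contracted_mean c d (\<lambda>y. contracted_mean p q (\<lambda>z. f (x, y, z)) r) s)"
    and "convex_on ({0..1} \<times> {0..1} \<times> {0..1}) (hadamard_map a b c d p q f)"
proof -
  have "convex_on (({a..b} \<times> {c..d}) \<times> {p..q}) (\<lambda>v. f (fst (fst v), snd (fst v), snd v))"
    by (rule convex_on_compose_affine[OF f]) (auto intro!: convex_Times)
  from convex_on_contracted_mean_joint[OF \<open>p < q\<close> _ this]
  show 1: "convex_on (({a..b} \<times> {c..d}) \<times> {0..1})
      (\<lambda>((x, y), r). contracted_mean p q (\<lambda>z. f (x, y, z)) r)"
    by (simp add: case_prod_unfold convex_Times)
  have "convex_on (({a..b} \<times> {0..1}) \<times> {c..d})
      (\<lambda>v. (\<lambda>((x, y), r). contracted_mean p q (\<lambda>z. f (x, y, z)) r)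
        ((fst (fst v), snd v), snd (fst v)))"
    by (rule convex_on_compose_affine[OF 1]) (auto intro!: convex_Times)
  from convex_on_contracted_mean_joint[OF \<open>c < d\<close> _ this]
  show 2: "convex_on (({a..b} \<times> {0..1}) \<times> {0..1})
      (\<lambda>((x, r), s). contracted_mean c d (\<lambda>y. contracted_mean p q (\<lambda>z. f (x, y, z)) r) s)"
    by (simp add: case_prod_unfold convex_Times)
  have "convex_on (({0..1} \<times> {0..1}) \<times> {a..b})
      (\<lambda>v. (\<lambda>((x, r), s). contracted_mean c d (\<lambda>y. contracted_mean p q (\<lambda>z. f (x, y, z)) r) s)
        ((snd v, snd (fst v)), fst (fst v)))"
    by (rule convex_on_compose_affine[OF 2]) (auto intro!: convex_Times)
  from convex_on_contracted_mean_joint[OF \<open>a < b\<close> _ this]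
  have 3: "convex_on (({0..1} \<times> {0..1}) \<times> {0..1})
      (\<lambda>v. hadamard_map a b c d p q f (snd v, fst v))"
    by (simp add: case_prod_unfold convex_Times hadamard_map_eq_contracted_means[symmetric])
  have "convex_on ({0..1} \<times> {0..1} \<times> {0..1})
      (\<lambda>w. (\<lambda>v. hadamard_map a b c d p q f (snd v, fst v)) (snd w, fst w))"
    by (rule convex_on_compose_affine[OF 3]) (auto intro!: convex_Times)
  then show "convex_on ({0..1} \<times> {0..1} \<times> {0..1}) (hadamard_map a b c d p q f)"
    by simp
qed

lemma convex_on_coords_if_convex_on:
  assumes g: "convex_on (I1 \<times> I2 \<times> I3) g" and "convex I1" and "convex I2" and "convex I3"
  shows "convex_on_coords I1 I2 I3 g"
  unfolding convex_on_coords_def case_prod_unfold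
  by (intro conjI ballI; rule convex_on_compose_affine[OF g])
    (use assms(2-4) in \<open>auto intro!: convex_Times simp: algebra_simps\<close>)

text \<open>
  Increasing the factor of one mean increases that mean, as its argument is convex; the means
  around it preserve the inequality.
\<close>

lemma nondecreasing_on_coords_hadamard_map:
  fixes a b c d p q :: real
  assumes "a < b" and "c < d" and "p < q"
    and f: "convex_on ({a..b} \<times> {c..d} \<times> {p..q}) f"
  shows "nondecreasing_on_coords {0..1} {0..1} {0..1} (hadamard_map a b c d p q f)"
proof -
  let ?M1 = "\<lambda>x y r. contracted_mean p q (\<lambda>z. f (x, y, z)) r"
  let ?M2 = "\<lambda>x s r. contracted_mean c d (\<lambda>y. ?M1 x y r) s"
  note inner = convex_on_iterated_contracted_means[OF assms]
  have conv0: "convex_on {p..q} (\<lambda>z. f (x, y, z))" if "x \<in> {a..b}" "y \<in> {c..d}" for x y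
    by (rule convex_on_compose_affine[OF f]) (use that in \<open>auto simp: algebra_simps\<close>)
  have conv1: "convex_on {c..d} (\<lambda>y. ?M1 x y r)" if "x \<in> {a..b}" "r \<in> {0..1}" for x r
    using convex_on_compose_affine[OF inner(1), of "{c..d}" "\<lambda>y. ((x, y), r)"] that
    by (simp add: algebra_simps)
  have conv2: "convex_on {a..b} (\<lambda>x. ?M2 x s r)" if "s \<in> {0..1}" "r \<in> {0..1}" for s r
    using convex_on_compose_affine[OF inner(2), of "{a..b}" "\<lambda>x. ((x, r), s)"] that
    by (simp add: algebra_simps)
  have mono1: "?M1 x y r \<le> ?M1 x y r'"
    if "x \<in> {a..b}" "y \<in> {c..d}" "r \<in> {0..1}" "r' \<in> {0..1}" "r \<le> r'" for x y r r'
    by (rule mono_onD[OF contracted_mean_mono[OF \<open>p < q\<close> conv0]]) (use that in auto)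
  have mono2: "?M2 x s r \<le> ?M2 x s' r"
    if "x \<in> {a..b}" "r \<in> {0..1}" "s \<in> {0..1}" "s' \<in> {0..1}" "s \<le> s'" for x r s s'
    by (rule mono_onD[OF contracted_mean_mono[OF \<open>c < d\<close> conv1]]) (use that in auto)
  show ?thesis
    unfolding nondecreasing_on_coords_def hadamard_map_eq_contracted_means
  proof (intro conjI ballI)
    fix s r :: real
    assume "s \<in> {0..1}" "r \<in> {0..1}"
    then show "mono_on {0..1} (\<lambda>t. contracted_mean a b (\<lambda>x. ?M2 x s r) t)"
      using contracted_mean_mono[OF \<open>a < b\<close> conv2] by simp
  next
    fix t r :: real
    assume tr: "t \<in> {0..1}" "r \<in> {0..1}"
    show "mono_on {0..1} (\<lambda>s. contracted_mean a b (\<lambda>x. ?M2 x s r) t)"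
      by (intro mono_onI contracted_mean_le \<open>a < b\<close> conv2 mono2 tr)
  next
    fix t s :: real
    assume ts: "t \<in> {0..1}" "s \<in> {0..1}"
    show "mono_on {0..1} (\<lambda>r. contracted_mean a b (\<lambda>x. ?M2 x s r) t)"
      by (intro mono_onI contracted_mean_le \<open>a < b\<close> \<open>c < d\<close> conv2 conv1 mono1 ts)
  qed
qed

lemma hadamard_map_1:
  fixes a b c d p q :: real
  assumes f: "convex_on ({a..b} \<times> {c..d} \<times> {p..q}) f"
  shows "hadamard_map a b c d p q f (1, 1, 1) =
    1 / ((b - a) * (d - c) * (q - p)) * integral ({a..b} \<times> {c..d} \<times> {p..q}) f"
proof -
  have slice: "integral ({c..d} \<times> {p..q}) (\<lambda>v. f (x, v)) =
      integral {c..d} (\<lambda>y. integral {p..q} (\<lambda>z. f (x, y, z)))" if "x \<in> {a..b}" for x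
    using integral_cbox_times_convex[of c d p q "\<lambda>v. f (x, v)"] convex_on_slice[OF f _ that]
    by (simp add: convex_Times)
  have "integral ({a..b} \<times> {c..d} \<times> {p..q}) f =
      integral {a..b} (\<lambda>x. integral ({c..d} \<times> {p..q}) (\<lambda>v. f (x, v)))"
    using integral_cbox_times_convex[of a b "(c, p)" "(d, q)" f] f by (simp add: cbox_Pair_eq)
  also have "\<dots> = integral {a..b} (\<lambda>x. integral {c..d} (\<lambda>y. integral {p..q} (\<lambda>z. f (x, y, z))))"
    by (rule integral_cong) (rule slice)
  finally show ?thesis
    by (simp add: hadamard_map_def)
qed

lemma hadamard_map_0:
  assumes "a < b" and "c < d" and "p < q"
  shows "hadamard_map a b c d p q f (0, 0, 0) = f ((a + b) / 2, (c + d) / 2, (p + q) / 2)"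
  by (simp only: hadamard_map_eq_contracted_means contracted_mean_0 assms)

lemma nondecreasing_on_coords_le:
  assumes "nondecreasing_on_coords I1 I2 I3 g"
    and "x \<in> I1" "x' \<in> I1" "x \<le> x'" and "y \<in> I2" "y' \<in> I2" "y \<le> y'"
    and "z \<in> I3" "z' \<in> I3" "z \<le> z'"
  shows "g (x, y, z) \<le> g (x', y', z')"
proof -
  have "g (x, y, z) \<le> g (x', y, z)"
    using assms unfolding nondecreasing_on_coords_def by (blast dest: mono_onD)
  also have "\<dots> \<le> g (x', y', z)"
    using assms unfolding nondecreasing_on_coords_def by (blast dest: mono_onD)
  also have "\<dots> \<le> g (x', y', z')"
    using assms unfolding nondecreasing_on_coords_def by (blast dest: mono_onD)
  finally show ?thesis .
qed

theorem theorem4: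
  fixes a b c d p q :: real
    and f :: "real \<times> real \<times> real \<Rightarrow> real"
  assumes "a < b" and "c < d" and "p < q"
    and "convex_on ({a..b} \<times> {c..d} \<times> {p..q}) f"
  shows "convex_on_coords {0..1} {0..1} {0..1} (hadamard_map a b c d p q f) \<and>
    (bdd_above (hadamard_map a b c d p q f ` ({0..1} \<times> {0..1} \<times> {0..1})) \<and>
     (SUP w \<in> {0..1} \<times> {0..1} \<times> {0..1}. hadamard_map a b c d p q f w) =
       1 / ((b - a) * (d - c) * (q - p)) * integral ({a..b} \<times> {c..d} \<times> {p..q}) f \<and>
     1 / ((b - a) * (d - c) * (q - p)) * integral ({a..b} \<times> {c..d} \<times> {p..q}) f =
       hadamard_map a b c d p q f (1, 1, 1)) \<and>
    (bdd_below (hadamard_map a b c d p q f ` ({0..1} \<times> {0..1} \<times> {0..1})) \<and>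
     (INF w \<in> {0..1} \<times> {0..1} \<times> {0..1}. hadamard_map a b c d p q f w) =
       f ((a + b) / 2, (c + d) / 2, (p + q) / 2) \<and>
     f ((a + b) / 2, (c + d) / 2, (p + q) / 2) = hadamard_map a b c d p q f (0, 0, 0)) \<and>
    nondecreasing_on_coords {0..1} {0..1} {0..1} (hadamard_map a b c d p q f)"
proof -
  let ?H = "hadamard_map a b c d p q f"
  let ?Q = "{0..1} \<times> {0..1} \<times> {0..1} :: (real \<times> real \<times> real) set"
  have mono: "nondecreasing_on_coords {0..1} {0..1} {0..1} ?H"
    by (rule nondecreasing_on_coords_hadamard_map[OF assms])
  have upper: "?H w \<le> ?H (1, 1, 1)" if "w \<in> ?Q" for w
    using nondecreasing_on_coords_le[OF mono] that by (cases w) auto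
  have lower: "?H (0, 0, 0) \<le> ?H w" if "w \<in> ?Q" for w
    using nondecreasing_on_coords_le[OF mono] that by (cases w) auto
  have "convex_on_coords {0..1} {0..1} {0..1} ?H"
    by (rule convex_on_coords_if_convex_on[OF convex_on_iterated_contracted_means(3)[OF assms]]) auto
  moreover have "bdd_above (?H ` ?Q)"
    by (rule bdd_aboveI2) (rule upper)
  moreover have "bdd_below (?H ` ?Q)"
    by (rule bdd_belowI2) (rule lower)
  moreover have "(SUP w \<in> ?Q. ?H w) = ?H (1, 1, 1)"
    by (rule cSup_eq_maximum) (use upper in auto)
  moreover have "(INF w \<in> ?Q. ?H w) = ?H (0, 0, 0)"
    by (rule cInf_eq_minimum) (use lower in auto)
  ultimately show ?thesis
    using mono hadamard_map_1[OF assms(4)] hadamard_map_0[OF assms(1-3), of f] by simp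
qed

end
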